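(* Let $Q_n$ denote the $n$-dimensional hypercube graph with $2^n$ vertices. Then $\operatorname{ept}(Q_n)=O(n\log n)$ as $n\to\infty$; that is, there exist constants $K>0$ and $n_0$ such that $\operatorname{ept}(Q_n)\le K\,n\log n$ for all integers $n\ge n_0$.
   Context: The hypercube graph $Q_n$ has vertex set $\{0,1\}^n$, with two vertices adjacent iff they differ in exactly one coordinate. Probabilistic zero forcing on a finite simple graph $G$: initially the vertices of a nonempty set $S$ are blue and all other vertices are white. At each discrete time step, independently for every ordered pair $(u,v)$ of adjacent vertices with $u$ blue and $v$ white (colors taken at the start of the step), $u$ forces $v$ with probability $C[u]/\deg u$, where $C[u]$ is the number of blue vertices in the closed neighborhood of $u$ (including $u$ itself). A white vertex forced by at least one blue vertex becomes blue at the end of the step; blue vertices stay blue forever. The propagation time of $S$ is the number of time steps until all vertices are blue, with value in $\mathbb{N}\cup\{\infty\}$; its expected value is $\operatorname{ept}(G,S)$. The expected propagation time of $G$ is $\operatorname{ept}(G)=\min_{v\in V(G)}\operatorname{ept}(G,\{v\})$. *)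

theory Defs
  imports
    "Graph_Theory.Pair_Digraph"
    "HOL-Probability.Probability"
begin

text \<open>
  A finite simple graph is a \<^locale>\<open>pair_graph\<close>: each undirected edge is represented by both of
  its arcs, so \<^term>\<open>parcs G\<close> is the set of ordered pairs of adjacent vertices and
  \<^const>\<open>out_degree\<close> is the degree.
\<close>

definition hypercube :: "nat \<Rightarrow> bool list pair_pre_digraph" where
  "hypercube n = \<lparr> pverts = {x. length x = n},
     parcs = {(x, y). length x = n \<and> length y = n \<and> card {i. i < n \<and> x ! i \<noteq> y ! i} = 1} \<rparr>"

definition closed_neighborhood :: "'a pair_pre_digraph \<Rightarrow> 'a \<Rightarrow> 'a set" where
  "closed_neighborhood G u = insert u {w. (u, w) \<in> parcs G}"

definition force_prob :: "'a pair_pre_digraph \<Rightarrow> 'a set \<Rightarrow> 'a \<Rightarrow> real" where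
  "force_prob G B u = card (closed_neighborhood G u \<inter> B) / out_degree (with_proj G) u"

definition forcing_pairs :: "'a pair_pre_digraph \<Rightarrow> 'a set \<Rightarrow> ('a \<times> 'a) set" where
  "forcing_pairs G B = {(u, v) \<in> parcs G. u \<in> B \<and> v \<notin> B}"

text \<open>The law of the blue set after one step, given the blue set \<open>B\<close> at its start.\<close>

definition pzf_step :: "'a pair_pre_digraph \<Rightarrow> 'a set \<Rightarrow> 'a set pmf" where
  "pzf_step G B =
     map_pmf (\<lambda>forces. B \<union> {v. \<exists>u. (u, v) \<in> forcing_pairs G B \<and> forces (u, v)})
       (Pi_pmf (forcing_pairs G B) False (\<lambda>(u, v). bernoulli_pmf (force_prob G B u)))"

text \<open>
  The process is the Markov chain \<open>X\<^sub>0, X\<^sub>1, \<dots>\<close> of blue sets with \<open>X\<^sub>0 = S\<close> and transition law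
  \<^const>\<open>pzf_step\<close>, realized by the Ionescu-Tulcea theorem on its path space \<open>nat \<Rightarrow> 'a set\<close>.
  \<^term>\<open>pzf_kernel G S t X\<close> is the conditional law of \<open>X\<^sub>t\<close> given \<open>X\<^sub>0, \<dots>, X\<^bsub>t-1\<^esub>\<close>.
\<close>

primrec pzf_kernel ::
    "'a pair_pre_digraph \<Rightarrow> 'a set \<Rightarrow> nat \<Rightarrow> (nat \<Rightarrow> 'a set) \<Rightarrow> 'a set measure" where
  "pzf_kernel G S 0 X = return (count_space UNIV) S"
| "pzf_kernel G S (Suc t) X = measure_pmf (pzf_step G (X t))"

definition pzf_process :: "'a pair_pre_digraph \<Rightarrow> 'a set \<Rightarrow> (nat \<Rightarrow> 'a set) measure" where
  "pzf_process G S = projective_family.lim UNIV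
     (Ionescu_Tulcea.CI (pzf_kernel G S) (\<lambda>_. count_space UNIV)) (\<lambda>_. count_space UNIV)"

text \<open>The infimum of the empty set is \<^term>\<open>\<infinity> :: enat\<close>.\<close>

definition prop_time :: "'a pair_pre_digraph \<Rightarrow> (nat \<Rightarrow> 'a set) \<Rightarrow> enat" where
  "prop_time G X = Inf {enat t | t. X t = pverts G}"

definition ept_from :: "'a pair_pre_digraph \<Rightarrow> 'a set \<Rightarrow> ennreal" where
  "ept_from G S = (\<integral>\<^sup>+ X. ennreal_of_enat (prop_time G X) \<partial>pzf_process G S)"

definition ept :: "'a pair_pre_digraph \<Rightarrow> ennreal" where
  "ept G = Min ((\<lambda>v. ept_from G {v}) ` pverts G)"


subsection \<open>Well-definedness\<close>

lemma pair_graph_hypercube: "pair_graph (hypercube n)"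
proof -
  have V: "finite {x :: bool list. length x = n}"
    using finite_lists_length_eq[of "UNIV :: bool set" n] by simp
  have sub: "parcs (hypercube n) \<subseteq> {x. length x = n} \<times> {x. length x = n}"
    by (auto simp: hypercube_def)
  have sym: "sym (parcs (hypercube n))"
  proof (rule symI)
    fix x y assume "(x, y) \<in> parcs (hypercube n)"
    moreover have "{i. i < n \<and> y ! i \<noteq> x ! i} = {i. i < n \<and> x ! i \<noteq> y ! i}" by blast
    ultimately show "(y, x) \<in> parcs (hypercube n)"
      by (simp add: hypercube_def del: not_iff)
  qed
  show ?thesis
  proof
    show "finite (parcs (hypercube n))"
      using finite_subset[OF sub] V by simp
    show "symmetric (with_proj (hypercube n))"
      using sym by (simp add: symmetric_def)
    show "finite (pverts (hypercube n))"
      using V by (simp add: hypercube_def)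
  next
    fix e assume e: "e \<in> parcs (hypercube n)"
    show "fst e \<in> pverts (hypercube n)" and "snd e \<in> pverts (hypercube n)"
      using subsetD[OF sub e] by (simp_all add: hypercube_def mem_Times_iff)
    show "fst e \<noteq> snd e"
      using e by (cases e) (auto simp: hypercube_def)
  qed
qed

lemma force_prob_bounds:
  assumes "pair_graph G" "(u, v) \<in> forcing_pairs G B"
  shows "0 \<le> force_prob G B u" "force_prob G B u \<le> 1"
proof -
  interpret pair_graph G by fact
  let ?N = "{w. (u, w) \<in> parcs G}"
  have uv: "(u, v) \<in> parcs G" "u \<in> B" "v \<notin> B"
    using assms(2) by (auto simp: forcing_pairs_def)
  have fin: "finite ?N"
    by (rule finite_subset[OF _ pair_finite_verts]) (auto dest: arc_snd_in_verts)
  have "bij_betw snd (out_arcs (with_proj G) u) ?N"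
    by (rule bij_betwI[where g = "\<lambda>w. (u, w)"]) (auto simp: out_arcs_def)
  then have deg: "out_degree (with_proj G) u = card ?N"
    unfolding out_degree_def by (rule bij_betw_same_card)
  have "closed_neighborhood G u \<inter> B \<subseteq> insert u (?N - {v})"
    using uv by (auto simp: closed_neighborhood_def)
  then have "card (closed_neighborhood G u \<inter> B) \<le> card (insert u (?N - {v}))"
    using fin by (intro card_mono) auto
  also have "\<dots> \<le> Suc (card (?N - {v}))"
    using fin by (simp add: card_insert_if)
  also have "\<dots> = card ?N"
    using fin uv card_Suc_Diff1[of ?N v] by simp
  finally have le: "card (closed_neighborhood G u \<inter> B) \<le> card ?N" .
  show "0 \<le> force_prob G B u"
    by (simp add: force_prob_def)
  show "force_prob G B u \<le> 1"
    using le unfolding force_prob_def deg by (simp add: divide_le_eq)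
qed

lemma Ionescu_Tulcea_pzf: "Ionescu_Tulcea (pzf_kernel G S) (\<lambda>_. count_space UNIV)"
proof (rule Ionescu_Tulcea.intro)
  fix t :: nat
  let ?M = "PiM {0..<t} (\<lambda>_. count_space UNIV) :: (nat \<Rightarrow> 'a set) measure"
  show "pzf_kernel G S t \<in> measurable ?M (subprob_algebra (count_space UNIV))"
  proof (cases t)
    case 0
    have "(\<lambda>_. return (count_space UNIV) S) \<in> measurable ?M (subprob_algebra (count_space UNIV))"
      by (rule measurable_const)
        (auto simp: space_subprob_algebra intro!: prob_space_imp_subprob_space prob_space_return)
    moreover have "pzf_kernel G S t = (\<lambda>_. return (count_space UNIV) S)"
      using 0 by (simp add: fun_eq_iff)
    ultimately show ?thesis by simp
  next
    case (Suc i)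
    have "(\<lambda>X. measure_pmf (pzf_step G (X i))) \<in> measurable ?M (subprob_algebra (count_space UNIV))"
      by (rule measurable_compose[of "\<lambda>X. X i" _ "count_space UNIV"])
        (use Suc in \<open>auto intro!: measurable_component_singleton measure_pmf_in_subprob_algebra\<close>)
    moreover have "pzf_kernel G S t = (\<lambda>X. measure_pmf (pzf_step G (X i)))"
      using Suc by (simp add: fun_eq_iff)
    ultimately show ?thesis by simp
  qed
next
  fix t :: nat and X :: "nat \<Rightarrow> 'a set"
  show "prob_space (pzf_kernel G S t X)"
    by (cases t) (auto intro!: prob_space_return measure_pmf.prob_space_axioms)
qed

lemma sets_pzf_process [measurable_cong]:
  "sets (pzf_process G S) = sets (PiM UNIV (\<lambda>_. count_space UNIV))"
proof -
  interpret Ionescu_Tulcea "pzf_kernel G S" "\<lambda>_. count_space UNIV"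
    by (rule Ionescu_Tulcea_pzf)
  show ?thesis
    unfolding pzf_process_def by simp
qed

lemma prob_space_pzf_process: "prob_space (pzf_process G S)"
proof -
  interpret Ionescu_Tulcea "pzf_kernel G S" "\<lambda>_. count_space UNIV"
    by (rule Ionescu_Tulcea_pzf)
  let ?M = "PiM {} (\<lambda>_. count_space UNIV) :: (nat \<Rightarrow> 'a set) measure"
  have "prob_space (distr (pzf_process G S) ?M (\<lambda>X. restrict X {}))"
    unfolding pzf_process_def by (subst distr_lim) (auto intro: PF.prob_space_P)
  moreover have "(\<lambda>X. restrict X {}) \<in> measurable (pzf_process G S) ?M"
    by (rule measurable_restrict) simp
  ultimately show ?thesis
    by (rule prob_space_distrD[rotated])
qed

lemma prop_time_measurable:
  "(\<lambda>X. ennreal_of_enat (prop_time G X)) \<in> borel_measurable (pzf_process G S)"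
proof -
  have [measurable]: "Measurable.pred (pzf_process G S) (\<lambda>X. X t = pverts G)" for t
    by measurable
  have eq: "ennreal_of_enat (prop_time G X) = (INF t. if X t = pverts G then of_nat t else \<infinity>)" for X
  proof (rule antisym)
    show "ennreal_of_enat (prop_time G X) \<le> (INF t. if X t = pverts G then of_nat t else \<infinity>)"
    proof (rule INF_greatest)
      fix t
      have "X t = pverts G \<Longrightarrow> prop_time G X \<le> enat t"
        unfolding prop_time_def by (intro Inf_lower) auto
      then show "ennreal_of_enat (prop_time G X) \<le> (if X t = pverts G then of_nat t else \<infinity>)"
        using ennreal_of_enat_le_iff[of "prop_time G X" "enat t"] by auto
    qed
    show "(INF t. if X t = pverts G then of_nat t else \<infinity>) \<le> ennreal_of_enat (prop_time G X)"
    proof (cases "{enat t | t. X t = pverts G} = {}")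
      case False
      then have "prop_time G X \<in> {enat t | t. X t = pverts G}"
        unfolding prop_time_def Inf_enat_def
        by (metis (mono_tags, lifting) LeastI_ex ex_in_conv)
      then obtain t where t: "prop_time G X = enat t" "X t = pverts G"
        by auto
      have "(INF t. if X t = pverts G then of_nat t else \<infinity>) \<le>
          (if X t = pverts G then of_nat t else \<infinity> :: ennreal)"
        by (rule INF_lower) simp
      also have "\<dots> = ennreal_of_enat (prop_time G X)"
        using t by simp
      finally show ?thesis .
    qed (auto simp: prop_time_def Inf_enat_def)
  qed
  show ?thesis
    unfolding eq by measurable
qed

text \<open>
  For \<open>t = 0\<close> this is the law of the initial blue set, and for \<open>t > 0\<close> the Markov property.
\<close>

lemma emeasure_pzf_process:
  assumes A: "A \<in> sets (PiM {0..<t} (\<lambda>_. count_space UNIV))"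
  shows "emeasure (pzf_process G S) {X. restrict X {0..<t} \<in> A \<and> X t \<in> B} =
    (\<integral>\<^sup>+ X. indicator A (restrict X {0..<t}) * emeasure (pzf_kernel G S t X) B \<partial>pzf_process G S)"
proof -
  interpret Ionescu_Tulcea "pzf_kernel G S" "\<lambda>_. count_space UNIV"
    by (rule Ionescu_Tulcea_pzf)
  let ?M = "\<lambda>J. PiM J (\<lambda>_. count_space UNIV) :: (nat \<Rightarrow> 'a set) measure"
  let ?u = "\<lambda>_. undefined :: 'a set"
  have u: "?u \<in> space (?M {0..<0})"
    by (simp add: space_PiM)
  have sets_C': "sets (C 0 n ?u) = sets (?M {0..<n})" for n
    using sets_C[OF u, of n] by simp
  have space_C': "space (C 0 n ?u) = space (?M {0..<n})" for n
    using space_C[OF u, of n] by simp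
  have restr: "(\<lambda>X. restrict X {0..<n}) \<in> measurable (pzf_process G S) (?M {0..<n})" for n
    by (rule measurable_restrict) simp
  have em: "emeasure (pzf_process G S) {X. restrict X {0..<n} \<in> D} = emeasure (C 0 n ?u) D"
    if D: "D \<in> sets (?M {0..<n})" for n D
  proof -
    have "{X. restrict X {0..<n} \<in> D} = PF.emb UNIV {0..<n} D"
      by (auto simp: prod_emb_def)
    moreover have "PF.emb {0..<n} {0..<n} D = D"
      using sets.sets_into_space[OF D] by (auto simp: prod_emb_def space_PiM)
    ultimately show ?thesis
      using emeasure_CI[of "{0..<n}" n D] D by (simp add: pzf_process_def lim)
  qed
  have distr: "distr (pzf_process G S) (?M {0..<n}) (\<lambda>X. restrict X {0..<n}) = C 0 n ?u" for n
  proof (rule measure_eqI)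
    fix D assume "D \<in> sets (distr (pzf_process G S) (?M {0..<n}) (\<lambda>X. restrict X {0..<n}))"
    then have D: "D \<in> sets (?M {0..<n})" by simp
    have "(\<lambda>X. restrict X {0..<n}) -` D \<inter> space (pzf_process G S) = {X. restrict X {0..<n} \<in> D}"
      using sets_eq_imp_space_eq[OF sets_pzf_process[of G S]] by (auto simp: space_PiM)
    then show "emeasure (distr (pzf_process G S) (?M {0..<n}) (\<lambda>X. restrict X {0..<n})) D =
        emeasure (C 0 n ?u) D"
      by (simp add: emeasure_distr[OF restr D] em[OF D])
  qed (simp add: sets_C')
  define D where "D = {X \<in> space (?M {0..<Suc t}). restrict X {0..<t} \<in> A \<and> X t \<in> B}"
  have r: "(\<lambda>X. restrict X {0..<t}) \<in> measurable (?M {0..<Suc t}) (?M {0..<t})"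
    by (rule measurable_restrict_subset) auto
  have c: "(\<lambda>X. X t) \<in> measurable (?M {0..<Suc t}) (count_space UNIV)"
    by (rule measurable_component_singleton) simp
  have D: "D \<in> sets (?M {0..<Suc t})"
  proof -
    have "D = ((\<lambda>X. restrict X {0..<t}) -` A \<inter> space (?M {0..<Suc t})) \<inter>
        ((\<lambda>X. X t) -` B \<inter> space (?M {0..<Suc t}))"
      by (auto simp: D_def)
    also have "\<dots> \<in> sets (?M {0..<Suc t})"
      by (intro sets.Int measurable_sets[OF r A] measurable_sets[OF c]) simp
    finally show ?thesis .
  qed
  have "restrict (restrict X {0..<Suc t}) {0..<t} = restrict X {0..<t}" for X :: "nat \<Rightarrow> 'a set"
    by (rule ext) (simp add: restrict_def)
  then have "{X. restrict X {0..<t} \<in> A \<and> X t \<in> B} = {X. restrict X {0..<Suc t} \<in> D}"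
    by (simp add: D_def space_PiM)
  then have "emeasure (pzf_process G S) {X. restrict X {0..<t} \<in> A \<and> X t \<in> B} =
      emeasure (C 0 (Suc t) ?u) D"
    using em[OF D] by simp
  also have "\<dots> = (\<integral>\<^sup>+ X. emeasure (eP t X) D \<partial>C 0 t ?u)"
    using measurable_eP[of t]
    by (simp, subst emeasure_bind[where N = "?M {0..<Suc t}"])
      (auto simp: space_C' D measurable_cong_sets[OF sets_C' refl])
  also have "\<dots> = (\<integral>\<^sup>+ X. indicator A X * emeasure (pzf_kernel G S t X) B \<partial>C 0 t ?u)"
  proof (rule nn_integral_cong)
    fix X assume "X \<in> space (C 0 t ?u)"
    then have X: "X \<in> space (?M {0..<t})" by (simp add: space_C')
    then have "restrict (X(t := x)) {0..<t} = X" for x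
      by (auto simp: space_PiM PiE_iff extensional_def restrict_def fun_eq_iff)
    moreover have "X(t := x) \<in> space (?M {0..<Suc t})" for x
      using X by (auto simp: space_PiM PiE_iff extensional_def)
    ultimately have "fun_upd X t -` D \<inter> space (count_space UNIV) = (if X \<in> A then B else {})"
      by (auto simp: D_def)
    then show "emeasure (eP t X) D = indicator A X * emeasure (pzf_kernel G S t X) B"
      using emeasure_eP[OF X D] by simp
  qed
  also have "\<dots> = (\<integral>\<^sup>+ X. indicator A (restrict X {0..<t}) *
      emeasure (pzf_kernel G S t (restrict X {0..<t})) B \<partial>pzf_process G S)"
    unfolding distr[symmetric]
  proof (rule nn_integral_distr[OF restr])
    have "(\<lambda>X. emeasure (pzf_kernel G S t X) B) \<in> borel_measurable (?M {0..<t})"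
      by (rule measurable_emeasure_kernel[OF P]) simp
    then show "(\<lambda>X. indicator A X * emeasure (pzf_kernel G S t X) B) \<in> borel_measurable
        (distr (pzf_process G S) (?M {0..<t}) (\<lambda>X. restrict X {0..<t}))"
      using A by measurable
  qed
  also have "\<dots> = (\<integral>\<^sup>+ X. indicator A (restrict X {0..<t}) *
      emeasure (pzf_kernel G S t X) B \<partial>pzf_process G S)"
    by (cases t) simp_all
  finally show ?thesis .
qed

end

theory Submission
  imports Defs
begin

text \<open>
  Give a white vertex \<open>v\<close> the cost \<open>min A\<^bsup>d(u,v)\<^esup> / C[u]\<close> over the blue vertices \<open>u\<close>, where
  \<open>A = 4(\<Delta> + 1)\<close> and \<open>\<Delta>\<close> is the maximum degree, and let \<open>u\<close> attain the minimum. If \<open>C[u]\<close>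
  is at most half of the degree of \<open>u\<close>, then \<open>C[u]\<close> increases by a binomial variable of mean at
  least \<open>C[u]/2\<close>, which contracts \<open>1/C[u]\<close> in expectation. Otherwise \<open>u\<close> forces its neighbor
  closer to \<open>v\<close> with probability at least \<open>1/2\<close>, and then the cost drops by a factor of 4. So in
  expectation the total cost of the white vertices shrinks by a factor of \<open>7/8\<close> in every step, while
  it is at least 1 until all vertices are blue. The expected propagation time is therefore at most
  logarithmic in the initial total cost, which for the hypercube is at most \<open>2\<^sup>n (4(n + 1))\<^sup>n\<close>.
\<close>

section \<open>Binomial moments and the contraction of a reciprocal\<close>

text \<open>The binomial point masses are the Bernstein polynomials, whose first moment sum is a
  known identity.\<close>

lemma expectation_binomial_pmf:
  assumes "p \<in> {0..1}"
  shows "measure_pmf.expectation (binomial_pmf n p) real = n * p"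
proof -
  have "measure_pmf.expectation (binomial_pmf n p) real = (\<Sum>k\<le>n. real k * Bernstein n k p)"
    using assms by (simp add: expectation_binomial_pmf' Bernstein_def mult_ac)
  then show ?thesis by simp
qed

lemma expectation_binomial_pmf_square:
  assumes "p \<in> {0..1}"
  shows "measure_pmf.expectation (binomial_pmf n p) (\<lambda>k. (real k)\<^sup>2) = n * p + n * (real n - 1) * p\<^sup>2"
proof -
  have "measure_pmf.expectation (binomial_pmf n p) (\<lambda>k. (real k)\<^sup>2) =
      (\<Sum>k\<le>n. (real k)\<^sup>2 * Bernstein n k p)"
    using assms by (simp add: expectation_binomial_pmf' Bernstein_def mult_ac)
  \<comment> \<open>Splitting \<open>k^2 = k (k - 1) + k\<close> reduces the second moment to the
    factorial moments of the Bernstein polynomials.\<close>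
  also have "\<dots> = (\<Sum>k\<le>n. real k * (real k - 1) * Bernstein n k p) + (\<Sum>k\<le>n. real k * Bernstein n k p)"
    unfolding sum.distrib[symmetric] by (rule sum.cong) (auto simp: power2_eq_square algebra_simps)
  finally show ?thesis by (simp add: sum_kk_Bernstein)
qed

text \<open>The quadratic agrees with \<open>1 / (k + x)\<close> at \<open>x = 0\<close> and is
  tangent to it at \<open>x = k\<close>; multiplied by \<open>k + x\<close>, the gap becomes
  \<open>x (k - x)^2 / (4 k^3)\<close>. The expectation of a reciprocal is thereby bounded by two
  moments.\<close>

lemma inverse_add_le_quadratic:
  fixes k x :: real
  assumes "k > 0" "x \<ge> 0"
  shows "1 / (k + x) \<le> 1 / k - 3 / (4 * k\<^sup>2) * x + 1 / (4 * k ^ 3) * x\<^sup>2"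
proof -
  have "(1 / k - 3 / (4 * k\<^sup>2) * x + 1 / (4 * k ^ 3) * x\<^sup>2) * (k + x) = 1 + x * (k - x)\<^sup>2 / (4 * k ^ 3)"
    using assms by (simp add: field_simps power2_eq_square power3_eq_cube)
  also have "\<dots> \<ge> 1" using assms by simp
  finally show ?thesis using assms by (simp add: divide_le_eq)
qed

text \<open>Models a blue vertex of degree \<open>d\<close> with \<open>k\<close> blue vertices in
  its closed neighborhood: it has \<open>Suc d - k\<close> white neighbors and forces each with
  probability \<open>k / d\<close>.\<close>

lemma expectation_binomial_pmf_inverse_add:
  assumes k: "k \<ge> 1" and d: "2 * k \<le> d"
  shows "measure_pmf.expectation (binomial_pmf (Suc d - k) (k / d)) (\<lambda>x. 1 / (real k + x)) \<le> 7 / 8 / k"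
proof -
  let ?m = "Suc d - k" and ?p = "real k / d"
  let ?E = "measure_pmf.expectation (binomial_pmf ?m ?p)"
  \<comment> \<open>The mean number of successes is \<open>k * y\<close>, and
    \<open>2 * k \<le> d\<close> puts \<open>y\<close> between 1/2 and 1.\<close>
  define y where "y = real ?m / d"
  have p: "?p \<in> {0..1}" using assms by auto
  have y: "1 / 2 \<le> y" "y \<le> 1" using assms by (auto simp: y_def field_simps of_nat_diff)
  have I: "integrable (binomial_pmf ?m ?p) f" for f :: "nat \<Rightarrow> real"
    using p by (intro integrable_measure_pmf_finite) auto
  have mp: "?m * ?p = k * y" by (simp add: y_def)
  have "?E (\<lambda>x. 1 / (real k + x)) \<le>
      ?E (\<lambda>x. 1 / k - 3 / (4 * (real k)\<^sup>2) * x + 1 / (4 * real k ^ 3) * (real x)\<^sup>2)"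
    using k by (intro integral_mono I inverse_add_le_quadratic) auto
  also have "\<dots> = 1 / k - 3 / (4 * (real k)\<^sup>2) * ?E real + 1 / (4 * real k ^ 3) * ?E (\<lambda>x. (real x)\<^sup>2)"
    by (simp add: I)
  also have "?E real = k * y"
    using expectation_binomial_pmf[OF p] mp by simp
  also have "?E (\<lambda>x. (real x)\<^sup>2) = k * y + (k * y)\<^sup>2 - k * y * ?p"
    unfolding expectation_binomial_pmf_square[OF p] mp[symmetric]
    by (simp add: power2_eq_square algebra_simps)
  \<comment> \<open>The negative part \<open>- k * y * ?p\<close> of the second moment is
    dropped.\<close>
  also have "1 / k - 3 / (4 * (real k)\<^sup>2) * (k * y) + 1 / (4 * real k ^ 3) * (k * y + (k * y)\<^sup>2 - k * y * ?p)
      \<le> 1 / k - 3 / (4 * (real k)\<^sup>2) * (k * y) + 1 / (4 * real k ^ 3) * (k * y + (k * y)\<^sup>2)"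
    using y k by (intro add_left_mono mult_left_mono) auto
  also have "\<dots> = (1 - 3 / 4 * y + y / (4 * k) + y\<^sup>2 / 4) / k"
    using k by (simp add: field_simps power2_eq_square power3_eq_cube)
  also have "\<dots> \<le> (7 / 8) / k"
  \<comment> \<open>With \<open>1 / k \<le> 1\<close> and \<open>y^2 \<le> y\<close> the numerator
    is at most \<open>1 - y / 4\<close>, and \<open>y \<ge> 1 / 2\<close> gives 7/8.\<close>
  proof (rule divide_right_mono)
    have "y / (4 * k) \<le> y / 4" using y k by (simp add: field_simps)
    moreover have "y\<^sup>2 \<le> y" using y by (simp add: power2_eq_square mult_left_le)
    ultimately show "1 - 3 / 4 * y + y / (4 * k) + y\<^sup>2 / 4 \<le> 7 / 8" using y by simp
  qed simp
  finally show ?thesis .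
qed


subsection \<open>One step of the process\<close>

context pair_graph
begin

lemma finite_neighbors: "finite {w. (u, w) \<in> parcs G}"
  by (rule finite_subset[OF _ pair_finite_verts]) (auto dest: arc_snd_in_verts)

lemma finite_closed_neighborhood: "finite (closed_neighborhood G u)"
  using finite_neighbors by (simp add: closed_neighborhood_def)

lemma out_degree_eq_card: "out_degree (with_proj G) u = card {w. (u, w) \<in> parcs G}"
proof -
  have "bij_betw snd (out_arcs (with_proj G) u) {w. (u, w) \<in> parcs G}"
    by (rule bij_betwI[where g = "\<lambda>w. (u, w)"]) (auto simp: out_arcs_def)
  then show ?thesis
    unfolding out_degree_def by (rule bij_betw_same_card)
qed

lemma card_closed_neighborhood: "card (closed_neighborhood G u) = Suc (out_degree (with_proj G) u)"
  using finite_neighbors no_loops[of "(u, u)"]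
  by (auto simp: closed_neighborhood_def out_degree_eq_card card_insert_if)

lemma finite_forcing_pairs: "finite (forcing_pairs G B)"
  by (rule finite_subset[OF _ pair_finite_arcs]) (auto simp: forcing_pairs_def)

lemma finite_set_forces:
  fixes q :: "'a \<times> 'a \<Rightarrow> bool pmf"
  shows "finite (set_pmf (Pi_pmf (forcing_pairs G B) False q))"
  using finite_forcing_pairs
  by (intro finite_subset[OF set_Pi_pmf_subset'] finite_PiE_dflt) (auto intro: finite_subset[OF subset_UNIV])

lemma finite_set_pzf_step: "finite (set_pmf (pzf_step G B))"
  using finite_set_forces by (simp add: pzf_step_def)

lemma integrable_pzf_step: "integrable (pzf_step G B) (f :: 'a set \<Rightarrow> real)"
  by (rule integrable_measure_pmf_finite[OF finite_set_pzf_step])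

lemma set_pzf_step:
  assumes "B' \<in> set_pmf (pzf_step G B)" "B \<subseteq> pverts G"
  shows "B \<subseteq> B'" "B' \<subseteq> pverts G"
  using assms by (auto simp: pzf_step_def forcing_pairs_def dest: arc_snd_in_verts)

text \<open>The coordinate \<open>(u, w)\<close> of the product law is Bernoulli with the force
  probability of \<open>u\<close>. Equality can fail because other blue vertices may force
  \<open>w\<close> too.\<close>

lemma expectation_blue_ge_force_prob:
  assumes uw: "(u, w) \<in> forcing_pairs G B"
  shows "force_prob G B u \<le> measure_pmf.expectation (pzf_step G B) (\<lambda>B'. of_bool (w \<in> B'))"
proof -
  let ?P = "Pi_pmf (forcing_pairs G B) False (\<lambda>(u, v). bernoulli_pmf (force_prob G B u))"
  have b: "0 \<le> force_prob G B u" "force_prob G B u \<le> 1"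
    using force_prob_bounds[OF _ uw] pair_graph_axioms by auto
  have "force_prob G B u = measure_pmf.expectation (bernoulli_pmf (force_prob G B u)) of_bool"
    using b by simp
  also have "bernoulli_pmf (force_prob G B u) = map_pmf (\<lambda>f. f (u, w)) ?P"
    using uw by (simp add: Pi_pmf_component finite_forcing_pairs)
  also have "measure_pmf.expectation \<dots> of_bool = measure_pmf.expectation ?P (\<lambda>f. of_bool (f (u, w)) :: real)"
    by simp
  also have "\<dots> \<le> measure_pmf.expectation ?P (\<lambda>f. of_bool
      (w \<in> B \<union> {v. \<exists>u. (u, v) \<in> forcing_pairs G B \<and> f (u, v)}))"
    using uw by (intro integral_mono integrable_measure_pmf_finite finite_set_forces) auto
  also have "\<dots> = measure_pmf.expectation (pzf_step G B) (\<lambda>B'. of_bool (w \<in> B'))"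
    by (simp add: pzf_step_def)
  finally show ?thesis .
qed

text \<open>The attempts of \<open>u\<close> on its white neighbors are independent with the common
  probability \<open>k / d\<close>, so their number of successes is binomial.\<close>

lemma expectation_inverse_blue_neighbors:
  fixes B u
  defines "k \<equiv> card (closed_neighborhood G u \<inter> B)"
  assumes u: "u \<in> B" and k: "2 * k \<le> out_degree (with_proj G) u"
  shows "measure_pmf.expectation (pzf_step G B) (\<lambda>B'. 1 / card (closed_neighborhood G u \<inter> B'))
    \<le> 7 / 8 / k"
proof -
  define d where "d = out_degree (with_proj G) u"
  define N where "N = closed_neighborhood G u - B"
  let ?F = "forcing_pairs G B"
  let ?q = "\<lambda>(u, v). bernoulli_pmf (force_prob G B u)"
  let ?P = "Pi_pmf ?F False ?q"
  let ?g = "\<lambda>f. B \<union> {v. \<exists>u. (u, v) \<in> ?F \<and> f (u, v)}"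
  define W where "W = {u} \<times> N"
  have WF: "W \<subseteq> ?F"
    using u by (auto simp: W_def N_def forcing_pairs_def closed_neighborhood_def)
  have finW: "finite W" using finite_subset[OF WF finite_forcing_pairs] .
  have k1: "k \<ge> 1"
    using u finite_closed_neighborhood unfolding k_def
    by (auto simp: Suc_le_eq card_gt_0_iff closed_neighborhood_def)
  have cardN: "card N = Suc d - k"
    using finite_closed_neighborhood[of u] card_closed_neighborhood[of u]
    by (simp add: N_def k_def d_def card_Diff_subset_Int)
  have cardW: "card W = Suc d - k" by (simp add: W_def cardN card_cartesian_product)
  have p: "real k / d \<in> {0..1}" using k k1 by (auto simp: d_def)
  have "binomial_pmf (Suc d - k) (k / d) =
      map_pmf (\<lambda>f. card {x \<in> W. f x}) (Pi_pmf W False (\<lambda>_. bernoulli_pmf (k / d)))"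
    by (rule binomial_pmf_altdef'[OF finW cardW p])
  also have "Pi_pmf W False (\<lambda>_. bernoulli_pmf (k / d)) = Pi_pmf W False ?q"
    by (rule Pi_pmf_cong) (auto simp: W_def force_prob_def k_def d_def)
  also have "\<dots> = map_pmf (\<lambda>f x. if x \<in> W then f x else False) ?P"
    by (rule Pi_pmf_subset[OF finite_forcing_pairs WF])
  also have "map_pmf (\<lambda>f. card {x \<in> W. f x}) \<dots> = map_pmf (\<lambda>f. card {x \<in> W. f x}) ?P"
    by (auto simp: map_pmf_comp intro!: map_pmf_cong arg_cong[where f = card])
  finally have binom: "binomial_pmf (Suc d - k) (k / d) = map_pmf (\<lambda>f. card {x \<in> W. f x}) ?P" .
  have "measure_pmf.expectation (pzf_step G B) (\<lambda>B'. 1 / card (closed_neighborhood G u \<inter> B'))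
      = measure_pmf.expectation ?P (\<lambda>f. 1 / card (closed_neighborhood G u \<inter> ?g f))"
    by (simp add: pzf_step_def)
  \<comment> \<open>Only forces by \<open>u\<close> itself are counted; those by other blue vertices
    can only enlarge the blue neighborhood.\<close>
  also have "\<dots> \<le> measure_pmf.expectation ?P (\<lambda>f. 1 / (real k + card {x \<in> W. f x}))"
  proof (intro integral_mono integrable_measure_pmf_finite finite_set_forces)
    fix f :: "'a \<times> 'a \<Rightarrow> bool"
    have "k + card {x \<in> W. f x} = card (closed_neighborhood G u \<inter> B) + card (snd ` {x \<in> W. f x})"
      by (subst card_image) (auto simp: k_def W_def inj_on_def)
    also have "\<dots> = card (closed_neighborhood G u \<inter> B \<union> snd ` {x \<in> W. f x})"
      using finite_closed_neighborhood finW
      by (intro card_Un_disjoint[symmetric]) (auto simp: W_def N_def)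
    also have "\<dots> \<le> card (closed_neighborhood G u \<inter> ?g f)"
      using finite_closed_neighborhood WF
      by (intro card_mono) (auto simp: W_def N_def intro!: exI[of _ u])
    finally have "real k + card {x \<in> W. f x} \<le> card (closed_neighborhood G u \<inter> ?g f)"
      by linarith
    then show "1 / card (closed_neighborhood G u \<inter> ?g f) \<le> 1 / (real k + card {x \<in> W. f x})"
      using k1 by (intro divide_left_mono mult_pos_pos) auto
  qed
  also have "\<dots> = measure_pmf.expectation (binomial_pmf (Suc d - k) (k / d)) (\<lambda>x. 1 / (real k + x))"
    by (simp add: binom)
  also have "\<dots> \<le> 7 / 8 / k"
    using k by (intro expectation_binomial_pmf_inverse_add k1) (simp add: d_def)
  finally show ?thesis .
qed

end


subsection \<open>The potential\<close>

text \<open>\<open>dist\<close> is axiomatized by its strict decrease along some arc towards the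
  target, so that the Hamming distance can be used directly.\<close>

locale distance_graph = pair_graph G for G :: "'a pair_pre_digraph" (structure) +
  fixes dist :: "'a \<Rightarrow> 'a \<Rightarrow> nat" and \<Delta> :: nat
  assumes descent: "u \<in> pverts G \<Longrightarrow> v \<in> pverts G \<Longrightarrow> u \<noteq> v \<Longrightarrow> \<exists>w. (u, w) \<in> parcs G \<and> dist w v < dist u v"
    and degree_le: "u \<in> pverts G \<Longrightarrow> out_degree (with_proj G) u \<le> \<Delta>"
begin

definition vertex_cost :: "'a set \<Rightarrow> 'a \<Rightarrow> 'a \<Rightarrow> real" where
  "vertex_cost B v u = (4 * real (\<Delta> + 1)) ^ dist u v / card (closed_neighborhood G u \<inter> B)"

definition cost :: "'a set \<Rightarrow> 'a \<Rightarrow> real" where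
  "cost B v = Min (vertex_cost B v ` B)"

definition potential :: "'a set \<Rightarrow> real" where
  "potential B = (\<Sum>v\<in>pverts G - B. cost B v)"

lemma blue_neighbors_bounds:
  assumes "u \<in> B" "B \<subseteq> pverts G"
  shows "1 \<le> card (closed_neighborhood G u \<inter> B)" "card (closed_neighborhood G u \<inter> B) \<le> \<Delta> + 1"
proof -
  show "1 \<le> card (closed_neighborhood G u \<inter> B)"
    using assms finite_closed_neighborhood[of u]
    by (auto simp: Suc_le_eq card_gt_0_iff closed_neighborhood_def)
  have "card (closed_neighborhood G u \<inter> B) \<le> card (closed_neighborhood G u)"
    using finite_closed_neighborhood by (intro card_mono) auto
  then show "card (closed_neighborhood G u \<inter> B) \<le> \<Delta> + 1"
    using assms degree_le[of u] card_closed_neighborhood[of u] by auto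
qed

lemma cost_le:
  assumes "u \<in> B" "B \<subseteq> pverts G"
  shows "cost B v \<le> vertex_cost B v u"
  using assms finite_subset[OF _ pair_finite_verts] by (auto simp: cost_def)

lemma cost_attained:
  assumes "B \<noteq> {}" "B \<subseteq> pverts G"
  obtains u where "u \<in> B" "cost B v = vertex_cost B v u"
proof -
  have "finite B" using assms finite_subset[OF _ pair_finite_verts] by auto
  then have "cost B v \<in> vertex_cost B v ` B"
    unfolding cost_def using assms by (intro Min_in) auto
  with that show ?thesis by auto
qed

text \<open>Moving closer gains a factor of at least \<open>4 * (\<Delta> + 1)\<close>, while the
  change of blue neighborhood count loses at most \<open>\<Delta> + 1\<close>. The set
  \<open>B'\<close> may differ from \<open>B\<close>, so the bound serves both before and after a
  step.\<close>

lemma vertex_cost_descent: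
  assumes "w \<in> B'" "B' \<subseteq> pverts G" "u \<in> B" "B \<subseteq> pverts G" "dist w v < dist u v"
  shows "cost B' v \<le> vertex_cost B v u / 4"
proof -
  let ?A = "4 * real (\<Delta> + 1)" and ?k = "card (closed_neighborhood G u \<inter> B)"
  have "cost B' v \<le> ?A ^ dist w v / card (closed_neighborhood G w \<inter> B')"
    using cost_le[OF assms(1,2)] by (simp add: vertex_cost_def)
  also have "\<dots> \<le> ?A ^ dist w v / 1"
    using blue_neighbors_bounds[OF assms(1,2)] by (intro divide_left_mono) auto
  also have "\<dots> \<le> ?A ^ (dist u v - 1)"
    using assms(5) by (simp only: div_by_1) (intro power_increasing; simp)
  also have "\<dots> = ?A ^ dist u v / ?A"
    using assms(5) by (simp add: power_diff)
  also have "\<dots> \<le> ?A ^ dist u v / (4 * ?k)"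
    using blue_neighbors_bounds[OF assms(3,4)] by (intro divide_left_mono) auto
  finally show ?thesis by (simp add: vertex_cost_def)
qed

text \<open>A white \<open>v\<close> differs from the minimizing blue \<open>u\<close>, so
  \<open>dist u v\<close> is positive and the numerator is at least
  \<open>4 * (\<Delta> + 1)\<close>, which exceeds the denominator.\<close>

lemma cost_ge_1:
  assumes B: "B \<noteq> {}" "B \<subseteq> pverts G" and v: "v \<in> pverts G - B"
  shows "1 \<le> cost B v"
proof -
  obtain u where u: "u \<in> B" "cost B v = vertex_cost B v u"
    using cost_attained[OF B] .
  let ?A = "4 * real (\<Delta> + 1)" and ?k = "card (closed_neighborhood G u \<inter> B)"
  obtain w where "dist w v < dist u v"
    using descent[of u v] u(1) B v by auto
  then have "?A ^ 1 \<le> ?A ^ dist u v" by (intro power_increasing) auto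
  moreover have "real ?k \<le> ?A" "1 \<le> ?k" using blue_neighbors_bounds[OF u(1) B(2)] by auto
  ultimately show ?thesis unfolding u(2) vertex_cost_def by (simp add: le_divide_eq)
qed

lemma cost_nonneg: "B \<noteq> {} \<Longrightarrow> B \<subseteq> pverts G \<Longrightarrow> 0 \<le> cost B v"
  by (rule cost_attained[of B v]) (auto simp: vertex_cost_def)

text \<open>The minimizer \<open>u\<close> for \<open>B\<close> stays blue, so it remains a
  candidate in the minimum for \<open>B'\<close>.\<close>

lemma expectation_cost:
  assumes B: "B \<noteq> {}" "B \<subseteq> pverts G" and v: "v \<in> pverts G - B"
  shows "measure_pmf.expectation (pzf_step G B) (\<lambda>B'. cost B' v) \<le> 7 / 8 * cost B v"
proof -
  let ?E = "measure_pmf.expectation (pzf_step G B)"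
  obtain u where u: "u \<in> B" "cost B v = vertex_cost B v u"
    using cost_attained[OF B] .
  let ?A = "4 * real (\<Delta> + 1)" and ?k = "\<lambda>B. card (closed_neighborhood G u \<inter> B)"
  let ?d = "out_degree (with_proj G) u"
  have pos: "0 \<le> cost B v" using cost_nonneg[OF B] .
  show ?thesis
  proof (cases "2 * ?k B \<le> ?d")
    case True
    have "?E (\<lambda>B'. cost B' v) \<le> ?E (\<lambda>B'. ?A ^ dist u v * (1 / ?k B'))"
    proof (intro integral_mono_AE integrable_pzf_step AE_pmfI)
      fix B' assume "B' \<in> set_pmf (pzf_step G B)"
      from set_pzf_step[OF this B(2)] u(1) have "cost B' v \<le> vertex_cost B' v u"
        by (intro cost_le) auto
      then show "cost B' v \<le> ?A ^ dist u v * (1 / ?k B')" by (simp add: vertex_cost_def)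
    qed
    also have "\<dots> = ?A ^ dist u v * ?E (\<lambda>B'. 1 / ?k B')"
      by (rule integral_mult_right_zero)
    also have "\<dots> \<le> ?A ^ dist u v * (7 / 8 / ?k B)"
      by (intro mult_left_mono expectation_inverse_blue_neighbors u(1) True) auto
    also have "\<dots> = 7 / 8 * cost B v" by (simp add: u(2) vertex_cost_def)
    finally show ?thesis .
  next
    case False
    obtain w where w: "(u, w) \<in> parcs G" "dist w v < dist u v"
      using descent[of u v] u(1) B v by auto
    \<comment> \<open>A blue \<open>w\<close> would have at most a quarter of the minimal cost,
      which is positive.\<close>
    have "w \<notin> B"
    proof
      assume "w \<in> B"
      then have "cost B v \<le> cost B v / 4"
        using vertex_cost_descent[of w B u B v] u B w by simp
      then show False using cost_ge_1[OF B v] by simp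
    qed
    then have uw: "(u, w) \<in> forcing_pairs G B" using u w by (simp add: forcing_pairs_def)
    have "0 < ?d"
      using w(1) finite_neighbors[of u] by (auto simp: out_degree_eq_card card_gt_0_iff)
    then have "1 / 2 \<le> force_prob G B u"
      using False by (simp add: force_prob_def field_simps)
    then have p: "(1 / 2 :: real) \<le> ?E (\<lambda>B'. of_bool (w \<in> B'))"
      using expectation_blue_ge_force_prob[OF uw] by simp
    \<comment> \<open>The cost falls to a quarter if \<open>w\<close> turns blue; otherwise
      \<open>u\<close> still bounds it by the old cost, since its blue neighborhood never
      shrinks.\<close>
    have "?E (\<lambda>B'. cost B' v) \<le> ?E (\<lambda>B'. cost B v - 3 / 4 * cost B v * of_bool (w \<in> B'))"
    proof (intro integral_mono_AE integrable_pzf_step AE_pmfI)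
      fix B' assume "B' \<in> set_pmf (pzf_step G B)"
      note B' = set_pzf_step[OF this B(2)]
      show "cost B' v \<le> cost B v - 3 / 4 * cost B v * of_bool (w \<in> B')"
      proof (cases "w \<in> B'")
        case True
        then show ?thesis using vertex_cost_descent[of w B' u B v] u B B' w by simp
      next
        case False
        have "cost B' v \<le> vertex_cost B' v u" using B' u(1) by (intro cost_le) auto
        also have "\<dots> \<le> vertex_cost B v u"
          using B' u(1) blue_neighbors_bounds(1)[of u B'] blue_neighbors_bounds(1)[OF u(1) B(2)]
            finite_closed_neighborhood[of u]
          unfolding vertex_cost_def
          by (intro divide_left_mono mult_pos_pos) (auto simp: Suc_le_eq intro!: card_mono)
        finally show ?thesis using False u(2) by simp
      qed
    qed
    also have "\<dots> = cost B v - 3 / 4 * cost B v * ?E (\<lambda>B'. of_bool (w \<in> B'))"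
      by (simp add: integrable_pzf_step)
    also have "\<dots> \<le> cost B v - 3 / 4 * cost B v * (1 / 2)"
      using pos by (intro diff_left_mono mult_left_mono p) auto
    also have "\<dots> \<le> 7 / 8 * cost B v" using pos by simp
    finally show ?thesis .
  qed
qed

lemma potential_nonneg: "B \<noteq> {} \<Longrightarrow> B \<subseteq> pverts G \<Longrightarrow> 0 \<le> potential B"
  unfolding potential_def by (intro sum_nonneg cost_nonneg)

text \<open>A single white vertex already contributes 1, so the potential dominates the indicator of
  unfinished propagation.\<close>

lemma potential_ge_1:
  assumes "B \<noteq> {}" "B \<subset> pverts G"
  shows "1 \<le> potential B"
proof -
  obtain v where v: "v \<in> pverts G - B" using assms by auto
  have "1 \<le> cost B v" using assms v by (intro cost_ge_1) auto
  also have "\<dots> \<le> potential B"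
    unfolding potential_def using assms v pair_finite_verts
    by (intro member_le_sum cost_nonneg) auto
  finally show ?thesis .
qed

lemma expectation_potential:
  assumes B: "B \<noteq> {}" "B \<subseteq> pverts G"
  shows "measure_pmf.expectation (pzf_step G B) potential \<le> 7 / 8 * potential B"
proof -
  let ?E = "measure_pmf.expectation (pzf_step G B)"
  \<comment> \<open>White vertices only disappear and costs are nonnegative, so summing over the old
    white set gives an upper bound over a fixed index set, where linearity applies.\<close>
  have "?E potential \<le> ?E (\<lambda>B'. \<Sum>v\<in>pverts G - B. cost B' v)"
  proof (intro integral_mono_AE integrable_pzf_step AE_pmfI)
    fix B' assume "B' \<in> set_pmf (pzf_step G B)"
    from set_pzf_step[OF this B(2)] B
    show "potential B' \<le> (\<Sum>v\<in>pverts G - B. cost B' v)"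
      unfolding potential_def using pair_finite_verts
      by (intro sum_mono2 cost_nonneg) auto
  qed
  also have "\<dots> = (\<Sum>v\<in>pverts G - B. ?E (\<lambda>B'. cost B' v))"
    by (simp add: integrable_pzf_step)
  also have "\<dots> \<le> (\<Sum>v\<in>pverts G - B. 7 / 8 * cost B v)"
    by (intro sum_mono expectation_cost B)
  finally show ?thesis by (simp add: potential_def sum_distrib_left)
qed


end


subsection \<open>The law of the blue set at a fixed time\<close>

text \<open>The one-dimensional marginals of the path-space process as iterated discrete laws, on
  which the potential argument is carried out.\<close>

primrec pzf_law :: "'a pair_pre_digraph \<Rightarrow> 'a set \<Rightarrow> nat \<Rightarrow> 'a set pmf" where
  "pzf_law G S 0 = return_pmf S"
| "pzf_law G S (Suc t) = bind_pmf (pzf_law G S t) (pzf_step G)"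

lemma space_pzf_process: "space (pzf_process G S) = UNIV"
  using sets_eq_imp_space_eq[OF sets_pzf_process[of G S]] by (simp add: space_PiM)

lemma emeasure_pzf_process_at:
  "emeasure (pzf_process G S) {X. X t \<in> D} = emeasure (pzf_law G S t) D"
proof (induction t arbitrary: D)
  \<comment> \<open>The Markov property with no restriction on the past.\<close>
  have key: "emeasure (pzf_process G S) {X. X t \<in> D} =
      (\<integral>\<^sup>+ X. emeasure (pzf_kernel G S t X) D \<partial>pzf_process G S)" for t D
    using emeasure_pzf_process[OF sets.top, of G S t D] by (simp add: space_PiM)
  {
    case 0
    interpret prob_space "pzf_process G S" by (rule prob_space_pzf_process)
    show ?case by (simp add: key emeasure_space_1)
  next
    case (Suc t)
    have m: "(\<lambda>X. X t) \<in> measurable (pzf_process G S) (count_space UNIV)"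
      by measurable
    have distr: "distr (pzf_process G S) (count_space UNIV) (\<lambda>X. X t) = measure_pmf (pzf_law G S t)"
      by (rule measure_eqI) (simp_all add: emeasure_distr[OF m] vimage_def space_pzf_process Suc)
    have "emeasure (pzf_process G S) {X. X (Suc t) \<in> D} =
        (\<integral>\<^sup>+ X. emeasure (pzf_step G (X t)) D \<partial>pzf_process G S)"
      by (simp add: key)
    also have "\<dots> = (\<integral>\<^sup>+ B. emeasure (pzf_step G B) D \<partial>pzf_law G S t)"
      unfolding distr[symmetric] by (rule nn_integral_distr[OF m, symmetric]) simp
    also have "\<dots> = (\<integral>\<^sup>+ B. \<integral>\<^sup>+ B'. indicator D B' \<partial>pzf_step G B \<partial>pzf_law G S t)"
      by simp
    also have "\<dots> = (\<integral>\<^sup>+ B. indicator D B \<partial>pzf_law G S (Suc t))"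
      unfolding pzf_law.simps by (rule nn_integral_bind_pmf[symmetric])
    also have "\<dots> = emeasure (pzf_law G S (Suc t)) D"
      by simp
    finally show ?case .
  }
qed

section \<open>The expected propagation time as a sum of tail probabilities\<close>

lemma prop_time_le_suminf:
  "ennreal_of_enat (prop_time G X) \<le> (\<Sum>t. indicator {X. X t \<noteq> pverts G} X)"
proof -
  let ?s = "\<Sum>t. indicator {X. X t \<noteq> pverts G} X :: ennreal"
  \<comment> \<open>In the finite case \<open>m\<close> is the propagation time itself; in the
    infinite case \<open>m\<close> is arbitrary and the sum diverges.\<close>
  have le: "of_nat m \<le> ?s" if "enat m \<le> prop_time G X" for m
  proof -
    have "X t \<noteq> pverts G" if "t < m" for t
    proof
      assume "X t = pverts G"
      then have "prop_time G X \<le> enat t"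
        unfolding prop_time_def by (intro Inf_lower) auto
      with \<open>enat m \<le> prop_time G X\<close> have "enat m \<le> enat t" by (rule order_trans)
      with that show False by simp
    qed
    then have "of_nat m = (\<Sum>t<m. indicator {X. X t \<noteq> pverts G} X :: ennreal)"
      by simp
    also have "\<dots> \<le> ?s" by (intro sum_le_suminf) auto
    finally show ?thesis .
  qed
  show ?thesis
  proof (cases "prop_time G X")
    case (enat m)
    then show ?thesis using le[of m] by simp
  next
    case infinity
    have "?s = \<top>"
    proof (rule ccontr)
      assume "?s \<noteq> \<top>"
      then obtain m :: nat where "?s < of_nat m" using ennreal_Ex_less_of_nat by (auto simp: less_top)
      with le[of m] infinity show False by simp
    qed
    then show ?thesis by simp
  qed
qed

lemma ept_from_le_suminf: "ept_from G S \<le> (\<Sum>t. emeasure (pzf_law G S t) (- {pverts G}))"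
proof -
  have m: "{X. X t \<noteq> pverts G} \<in> sets (pzf_process G S)" for t
  proof -
    have "Measurable.pred (pzf_process G S) (\<lambda>X. X t \<noteq> pverts G)" by measurable
    then show ?thesis by (simp add: pred_def space_pzf_process)
  qed
  have "ept_from G S \<le> (\<integral>\<^sup>+ X. (\<Sum>t. indicator {X. X t \<noteq> pverts G} X) \<partial>pzf_process G S)"
    unfolding ept_from_def by (intro nn_integral_mono prop_time_le_suminf)
  also have "\<dots> = (\<Sum>t. emeasure (pzf_process G S) {X. X t \<noteq> pverts G})"
    using m by (subst nn_integral_suminf) auto
  also have "\<dots> = (\<Sum>t. emeasure (pzf_law G S t) (- {pverts G}))"
    using emeasure_pzf_process_at[of G S _ "- {pverts G}"] by simp
  finally show ?thesis .
qed

text \<open>The terms before time \<open>T\<close>, roughly \<open>8 * ln M\<close>, are bounded by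
  1; from then on they are below a geometric series of sum 8. Rounding \<open>T\<close> up costs the
  remaining 1 in the constant 9.\<close>

lemma suminf_truncated_geometric_le:
  fixes f :: "nat \<Rightarrow> ennreal" and M :: real
  assumes 1: "\<And>t. f t \<le> 1" and f: "\<And>t. f t \<le> ennreal ((7 / 8) ^ t * M)" and M: "M \<ge> 1"
  shows "(\<Sum>t. f t) \<le> ennreal (8 * ln M + 9)"
proof -
  define T where "T = nat \<lceil>8 * ln M\<rceil>"
  have lnM: "0 \<le> ln M" using M by simp
  have T: "8 * ln M \<le> real T" "real T \<le> 8 * ln M + 1"
    using lnM unfolding T_def by linarith+
  \<comment> \<open>From \<open>1 - 1 / 8 \<le> exp (- 1 / 8)\<close>; this is the source of the
    factor 8 in \<open>T\<close>.\<close>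
  have "(7 / 8 :: real) ^ T \<le> exp (- 1 / 8) ^ T"
    using exp_ge_add_one_self[of "- 1 / 8 :: real"] by (intro power_mono) auto
  also have "\<dots> = exp (- real T / 8)" by (simp flip: exp_of_nat_mult)
  also have "\<dots> \<le> exp (- ln M)" using T by simp
  also have "\<dots> = 1 / M" using M by (simp add: exp_minus inverse_eq_divide)
  finally have small: "(7 / 8) ^ T * M \<le> 1" using M by (simp add: field_simps)
  define g :: "nat \<Rightarrow> real" where "g t = (if t < T then 1 else (7 / 8) ^ (t - T))" for t
  have g_nonneg: "0 \<le> g t" for t by (simp add: g_def)
  have "(\<lambda>t. (7 / 8 :: real) ^ t) sums 8"
    using geometric_sums[of "7 / 8 :: real"] by simp
  then have "(\<lambda>t. g (t + T)) sums ((T + 8) - sum g {..<T})"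
    by (simp add: g_def)
  then have g: "g sums (T + 8)"
    using sums_iff_shift[of g T "real (T + 8) - sum g {..<T}"] by simp
  have "f t \<le> ennreal (g t)" for t
  proof (cases "t < T")
    case False
    have "(7 / 8) ^ t * M = (7 / 8) ^ (t - T) * ((7 / 8) ^ T * M)"
      using False by (simp flip: power_add mult.assoc)
    also have "\<dots> \<le> (7 / 8) ^ (t - T) * 1"
      by (intro mult_left_mono small) simp
    finally have "ennreal ((7 / 8) ^ t * M) \<le> ennreal (g t)"
      using False by (intro ennreal_leI) (simp add: g_def)
    with f[of t] show ?thesis by (rule order_trans)
  qed (use 1 in \<open>simp add: g_def\<close>)
  then have "(\<Sum>t. f t) \<le> (\<Sum>t. ennreal (g t))" by (intro suminf_le) auto
  also have "\<dots> = ennreal (T + 8)"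
    using g by (intro suminf_ennreal_eq) (simp_all add: g_nonneg)
  also have "\<dots> \<le> ennreal (8 * ln M + 9)" using T by (intro ennreal_leI) simp
  finally show ?thesis .
qed

section \<open>Logarithmic bound on the expected propagation time\<close>

context distance_graph
begin

lemma set_pzf_law:
  assumes "S \<subseteq> pverts G" "B \<in> set_pmf (pzf_law G S t)"
  shows "S \<subseteq> B \<and> B \<subseteq> pverts G"
  using assms(2)
proof (induction t arbitrary: B)
  case (Suc t)
  then obtain B0 where "S \<subseteq> B0" "B0 \<subseteq> pverts G" "B \<in> set_pmf (pzf_step G B0)" by auto
  then show ?case using set_pzf_step[of B B0] by blast
qed (use assms(1) in auto)

text \<open>Every blue set in the support contains the nonempty \<open>S\<close>, so the one-step
  contraction applies at each time and iterates.\<close>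

lemma nn_integral_potential:
  assumes S: "S \<noteq> {}" "S \<subseteq> pverts G"
  shows "(\<integral>\<^sup>+ B. ennreal (potential B) \<partial>pzf_law G S t) \<le> ennreal ((7 / 8) ^ t * potential S)"
proof (induction t)
  case (Suc t)
  have "(\<integral>\<^sup>+ B. ennreal (potential B) \<partial>pzf_law G S (Suc t)) =
      (\<integral>\<^sup>+ B. \<integral>\<^sup>+ B'. ennreal (potential B') \<partial>pzf_step G B \<partial>pzf_law G S t)"
    by simp
  also have "\<dots> \<le> (\<integral>\<^sup>+ B. ennreal (7 / 8) * ennreal (potential B) \<partial>pzf_law G S t)"
  proof (intro nn_integral_mono_AE AE_pmfI)
    fix B assume "B \<in> set_pmf (pzf_law G S t)"
    from set_pzf_law[OF S(2) this] S have B: "B \<noteq> {}" "B \<subseteq> pverts G" by auto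
    have "(\<integral>\<^sup>+ B'. ennreal (potential B') \<partial>pzf_step G B) =
        ennreal (measure_pmf.expectation (pzf_step G B) potential)"
      using set_pzf_step[OF _ B(2)] B
      by (intro nn_integral_eq_integral integrable_pzf_step AE_pmfI potential_nonneg) auto
    also have "\<dots> \<le> ennreal (7 / 8 * potential B)"
      by (intro ennreal_leI expectation_potential B)
    finally show "(\<integral>\<^sup>+ B'. ennreal (potential B') \<partial>pzf_step G B) \<le> ennreal (7 / 8) * ennreal (potential B)"
      using potential_nonneg[OF B] by (simp flip: ennreal_mult)
  qed
  also have "\<dots> = ennreal (7 / 8) * (\<integral>\<^sup>+ B. ennreal (potential B) \<partial>pzf_law G S t)"
    by (rule nn_integral_cmult) simp
  also have "\<dots> \<le> ennreal (7 / 8) * ennreal ((7 / 8) ^ t * potential S)"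
    by (intro mult_left_mono Suc.IH) simp
  also have "\<dots> = ennreal ((7 / 8) ^ Suc t * potential S)"
    using potential_nonneg[OF S] by (simp add: mult.assoc flip: ennreal_mult)
  finally show ?case .
qed simp

text \<open>Markov's inequality for the potential gives geometric tails. A separate bound
  \<open>M \<ge> 1\<close> is used because the potential is 0 when \<open>S\<close> is
  everything.\<close>

lemma ept_from_le_ln_potential:
  assumes S: "S \<noteq> {}" "S \<subseteq> pverts G" and M: "potential S \<le> M" "M \<ge> 1"
  shows "ept_from G S \<le> ennreal (8 * ln M + 9)"
proof -
  have "emeasure (pzf_law G S t) (- {pverts G}) \<le> ennreal ((7 / 8) ^ t * M)" for t
  proof -
    have "emeasure (pzf_law G S t) (- {pverts G}) = (\<integral>\<^sup>+ B. indicator (- {pverts G}) B \<partial>pzf_law G S t)"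
      by simp
    also have "\<dots> \<le> (\<integral>\<^sup>+ B. ennreal (potential B) \<partial>pzf_law G S t)"
    proof (intro nn_integral_mono_AE AE_pmfI)
      fix B assume "B \<in> set_pmf (pzf_law G S t)"
      from set_pzf_law[OF S(2) this] S potential_ge_1[of B]
      show "indicator (- {pverts G}) B \<le> ennreal (potential B)"
        by (cases "B = pverts G") (auto simp: indicator_def)
    qed
    also have "\<dots> \<le> ennreal ((7 / 8) ^ t * potential S)"
      by (rule nn_integral_potential[OF S])
    also have "\<dots> \<le> ennreal ((7 / 8) ^ t * M)"
      by (intro ennreal_leI mult_left_mono M) simp
    finally show ?thesis .
  qed
  then have "(\<Sum>t. emeasure (pzf_law G S t) (- {pverts G})) \<le> ennreal (8 * ln M + 9)"
    by (intro suminf_truncated_geometric_le M measure_pmf.emeasure_le_1)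
  with ept_from_le_suminf show ?thesis by (rule order_trans)
qed

lemma ept_le:
  assumes s: "s \<in> pverts G" and r: "\<And>v. v \<in> pverts G \<Longrightarrow> dist s v \<le> r"
  shows "ept G \<le> ennreal (8 * ln (card (pverts G) * (4 * real (\<Delta> + 1)) ^ r) + 9)"
proof -
  let ?A = "4 * real (\<Delta> + 1)"
  have S: "{s} \<noteq> {}" "{s} \<subseteq> pverts G" using s by auto
  have cost: "cost {s} v \<le> ?A ^ r" if "v \<in> pverts G" for v
  proof -
    have "cost {s} v \<le> ?A ^ dist s v / card (closed_neighborhood G s \<inter> {s})"
      using cost_le[OF _ S(2), of s v] by (simp add: vertex_cost_def)
    \<comment> \<open>Initially \<open>s\<close> sees only itself as blue, so the denominator of its
      cost is 1.\<close>
    also have "closed_neighborhood G s \<inter> {s} = {s}" by (auto simp: closed_neighborhood_def)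
    also have "?A ^ dist s v / card {s} \<le> ?A ^ r"
      using r[OF that] by (auto intro!: power_increasing)
    finally show ?thesis .
  qed
  have "potential {s} \<le> card (pverts G - {s}) * ?A ^ r"
    unfolding potential_def using cost by (intro sum_bounded_above) auto
  also have "\<dots> \<le> card (pverts G) * ?A ^ r"
    using pair_finite_verts by (intro mult_right_mono) (auto intro: card_mono)
  finally have M: "potential {s} \<le> card (pverts G) * ?A ^ r" .
  have "1 \<le> card (pverts G)"
    using s pair_finite_verts by (auto simp: Suc_le_eq card_gt_0_iff)
  then have "1 * 1 \<le> real (card (pverts G)) * ?A ^ r"
    by (intro mult_mono one_le_power) auto
  with M have "ept_from G {s} \<le> ennreal (8 * ln (card (pverts G) * ?A ^ r) + 9)"
    by (intro ept_from_le_ln_potential S) auto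
  moreover have "ept G \<le> ept_from G {s}"
    unfolding ept_def using s pair_finite_verts by (intro Min_le) auto
  ultimately show ?thesis by (rule order_trans[rotated])
qed

end


subsection \<open>The hypercube\<close>

definition hamming_dist :: "'a list \<Rightarrow> 'a list \<Rightarrow> nat" where
  "hamming_dist x y = card {i. i < length x \<and> x ! i \<noteq> y ! i}"

lemma hamming_dist_le_length: "hamming_dist x y \<le> length x"
proof -
  have "card {i. i < length x \<and> x ! i \<noteq> y ! i} \<le> card {..<length x}"
    by (intro card_mono) auto
  then show ?thesis by (simp add: hamming_dist_def)
qed

text \<open>Overwrite one coordinate in which \<open>u\<close> and \<open>v\<close> differ by its
  value in \<open>v\<close>.\<close>

lemma hamming_dist_descent:
  assumes "length u = length v" "u \<noteq> v"
  obtains w where "length w = length u" "hamming_dist u w = 1" "hamming_dist w v < hamming_dist u v"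
proof -
  obtain i where i: "i < length u" "u ! i \<noteq> v ! i"
    using assms by (auto simp: list_eq_iff_nth_eq)
  define w where "w = u[i := v ! i]"
  have w: "w ! j = (if j = i then v ! i else u ! j)" if "j < length u" for j
    using that i by (simp add: w_def nth_list_update)
  have len: "length w = length u" by (simp add: w_def)
  have "{j. j < length u \<and> u ! j \<noteq> w ! j} = {i}"
    using i w by (auto split: if_splits)
  then have "hamming_dist u w = 1" by (simp add: hamming_dist_def)
  moreover have "{j. j < length u \<and> w ! j \<noteq> v ! j} = {j. j < length u \<and> u ! j \<noteq> v ! j} - {i}"
  proof (rule set_eqI)
    fix j
    show "j \<in> {j. j < length u \<and> w ! j \<noteq> v ! j} \<longleftrightarrow>
        j \<in> {j. j < length u \<and> u ! j \<noteq> v ! j} - {i}"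
      using w[of j] by (cases "j = i"; cases "j < length u") simp_all
  qed
  then have "hamming_dist w v < hamming_dist u v"
    unfolding hamming_dist_def len using i by (simp only:) (rule card_Diff1_less; simp)
  ultimately show thesis using len that by blast
qed

lemma parcs_hypercube:
  "parcs (hypercube n) = {(x, y). length x = n \<and> length y = n \<and> hamming_dist x y = 1}"
  unfolding hypercube_def hamming_dist_def by (simp cong: conj_cong del: not_iff)

lemma pverts_hypercube: "pverts (hypercube n) = {x. length x = n}"
  by (simp add: hypercube_def)

lemma distance_graph_hypercube: "distance_graph (hypercube n) hamming_dist n"
proof (intro distance_graph.intro distance_graph_axioms.intro pair_graph_hypercube)
  fix u v assume "u \<in> pverts (hypercube n)" "v \<in> pverts (hypercube n)" "u \<noteq> v"
  then show "\<exists>w. (u, w) \<in> parcs (hypercube n) \<and> hamming_dist w v < hamming_dist u v"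
    using hamming_dist_descent[of u v] by (auto simp: pverts_hypercube parcs_hypercube)
next
  fix u assume "u \<in> pverts (hypercube n)"
  then have len: "length u = n" by (simp add: pverts_hypercube)
  \<comment> \<open>Every neighbor is a flip of one of the \<open>n\<close> coordinates, which
    bounds the degree by \<open>n\<close>.\<close>
  have "{w. (u, w) \<in> parcs (hypercube n)} \<subseteq> (\<lambda>i. u[i := \<not> u ! i]) ` {..<n}"
  proof
    fix w assume "w \<in> {w. (u, w) \<in> parcs (hypercube n)}"
    then have w: "length w = n" and "hamming_dist u w = 1"
      by (simp_all add: parcs_hypercube)
    from this(2) obtain i where i: "{i. i < n \<and> u ! i \<noteq> w ! i} = {i}"
      unfolding hamming_dist_def len by (rule card_1_singletonE)
    have "w ! j = u[i := \<not> u ! i] ! j" if "j < n" for j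
    proof (cases "j = i")
      case True
      have "i \<in> {i. i < n \<and> u ! i \<noteq> w ! i}" unfolding i by simp
      with True len show ?thesis by simp
    next
      case False
      then have "j \<notin> {i. i < n \<and> u ! i \<noteq> w ! i}" unfolding i by simp
      with False that show ?thesis by simp
    qed
    then have "w = u[i := \<not> u ! i]" using len w by (intro nth_equalityI) simp_all
    moreover have "i < n" using i by blast
    ultimately show "w \<in> (\<lambda>i. u[i := \<not> u ! i]) ` {..<n}" by blast
  qed
  then have "card {w. (u, w) \<in> parcs (hypercube n)} \<le> card {..<n}"
    by (rule surj_card_le[rotated]) simp
  then show "out_degree (with_proj (hypercube n)) u \<le> n"
    by (simp only: pair_graph.out_degree_eq_card[OF pair_graph_hypercube] card_lessThan)
qed

lemma ept_hypercube_le: "ept (hypercube n) \<le> ennreal (8 * ln (2 ^ n * (4 * (real n + 1)) ^ n) + 9)"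
proof -
  have "hamming_dist (replicate n False) v \<le> n" for v
    using hamming_dist_le_length[of "replicate n False" v] by simp
  then have "ept (hypercube n) \<le>
      ennreal (8 * ln (card (pverts (hypercube n)) * (4 * real (n + 1)) ^ n) + 9)"
    by (intro distance_graph.ept_le[OF distance_graph_hypercube, of "replicate n False"])
      (simp_all add: pverts_hypercube)
  moreover have "card {x :: bool list. length x = n} = 2 ^ n"
    using card_lists_length_eq[of "UNIV :: bool set" n] by simp
  ultimately show ?thesis
    by (simp add: pverts_hypercube algebra_simps)
qed

theorem theorem1p3:
  shows "\<exists>K::real. K > 0 \<and> (\<exists>n0::nat. \<forall>n\<ge>n0. ept (hypercube n) \<le> ennreal (K * real n * ln (real n)))"
\<comment> \<open>For \<open>n \<ge> 9\<close> the logarithm contributes at most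
  \<open>24 * n * ln n\<close>, where 24 is 8 times the exponent in
  \<open>8 * (n + 1) \<le> n^3\<close>. The constant 9 is at most \<open>n * ln n\<close>, so
  \<open>33 = 24 + 9\<close> suffices.\<close>
proof (intro exI[of _ "33::real"] exI[of _ "9::nat"] conjI allI impI)
  fix n :: nat assume n: "9 \<le> n"
  have ln: "1 \<le> ln (real n)"
    using n exp_le by (subst ln_ge_iff) auto
  have "2 * (4 * (real n + 1)) \<le> real n ^ 3"
  proof -
    have "2 * (4 * (real n + 1)) \<le> 9 * (9 * real n)" using n by simp
    also have "\<dots> \<le> real n * (real n * real n)"
      using n by (intro mult_mono) auto
    finally show ?thesis by (simp add: power3_eq_cube)
  qed
  then have "ln (2 * (4 * (real n + 1))) \<le> ln (real n ^ 3)"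
    using n by (subst ln_le_cancel_iff) auto
  also have "\<dots> = 3 * ln (real n)" using n by (simp add: ln_realpow)
  finally have "ln ((2 * (4 * (real n + 1))) ^ n) \<le> n * (3 * ln (real n))"
    using n by (subst ln_realpow) (auto intro!: mult_left_mono)
  moreover have "9 * 1 \<le> real n * ln (real n)"
    using n ln by (intro mult_mono) auto
  ultimately have "8 * ln (2 ^ n * (4 * (real n + 1)) ^ n) + 9 \<le> 33 * real n * ln (real n)"
    unfolding power_mult_distrib[symmetric] by argo
  then show "ept (hypercube n) \<le> ennreal (33 * real n * ln (real n))"
    by (intro order_trans[OF ept_hypercube_le] ennreal_leI)
qed simp

end
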